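(* Let $a:[0,1]\to[0,\infty)$ be continuous and suppose there is a point $x_0\in[0,1]$ such that $a(x_0)=0$, $a>0$ on $[0,1]\setminus\{x_0\}$ and $\frac1a\notin L^1(0,1)$. Assume that there exist $K\in[1,2]$ and $C>0$ such that $\frac{1}{a(x)}\le\frac{C}{|x-x_0|^K}$ for all $x\in[0,1]\setminus\{x_0\}$. Assume moreover that $a\in W^{1,\infty}(0,1)$ and that $a$ is: non increasing on the left and non decreasing on the right of $x_0$, if $x_0\in(0,1)$; non decreasing on the right of $x_0$, if $x_0=0$; non increasing on the left of $x_0$, if $x_0=1$. Let $$D(A):=\left\{u\in H^2_{\frac1a}(0,1):\ au''''\in L^2_{\frac1a}(0,1)\right\}$$ and $$D:=\left\{u\in H^2_{\frac1a}(0,1):\ au''''\in L^2_{\frac1a}(0,1),\ u(x_0)=(au')(x_0)=(au'')(x_0)=0\right\}.$$ Then $D(A)=D$.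
   Context: Functions are real valued. $L^2_{\frac1a}(0,1):=\{u\in L^2(0,1): \int_0^1 \frac{u^2}{a}\,dx<+\infty\}$. $H^2_0(0,1):=\{u\in H^2(0,1): u(j)=u'(j)=0,\ j=0,1\}$ and $H^2_{\frac1a}(0,1):=L^2_{\frac1a}(0,1)\cap H^2_0(0,1)$. Derivatives are in the sense of distributions on $(0,1)$; the condition $au''''\in L^2_{\frac1a}(0,1)$ means that $u''''$ is a (locally integrable) function on $(0,1)$ and $au''''\in L^2_{\frac1a}(0,1)$. For such $u$ the function $au''$ is continuous on $[0,1]\setminus\{x_0\}$, and $(au'')(x_0)=0$ means $\lim_{x\to x_0}(au'')(x)=0$ (a one-sided limit if $x_0\in\{0,1\}$). *)

theory Defs
  imports "HOL-Analysis.Analysis"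
begin

text \<open>
  An element of a function space on the interval (0,1) is represented by a function
  \<^typ>\<open>real \<Rightarrow> real\<close>, whose values outside (0,1) are irrelevant. Every space below is a set of
  such representatives that is closed under equality almost everywhere on (0,1), so that equality
  of two such sets is equality of the corresponding sets of a.e.-classes. Pointwise statements
  about a class refer to its (unique) continuous representative.
\<close>

abbreviation I01 :: "real set" where
  "I01 \<equiv> {0<..<1}"

definition ae_eq :: "(real \<Rightarrow> real) \<Rightarrow> (real \<Rightarrow> real) \<Rightarrow> bool" where
  "ae_eq f g \<longleftrightarrow> (AE x in lebesgue. x \<in> I01 \<longrightarrow> f x = g x)"

definition L2 :: "(real \<Rightarrow> real) set" where
  "L2 = {u. set_borel_measurable lebesgue I01 u \<and> set_integrable lebesgue I01 (\<lambda>x. (u x)\<^sup>2)}"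

definition Linf :: "(real \<Rightarrow> real) set" where
  "Linf = {u. set_borel_measurable lebesgue I01 u \<and>
              (\<exists>M. AE x in lebesgue. x \<in> I01 \<longrightarrow> \<bar>u x\<bar> \<le> M)}"

definition L1_loc :: "(real \<Rightarrow> real) set" where
  "L1_loc = {u. \<forall>K. compact K \<and> K \<subseteq> I01 \<longrightarrow> set_integrable lebesgue K u}"

text \<open>
  The weight is only used when it vanishes in at most one point of [0,1], so the convention
  \<^term>\<open>y / 0 = (0::real)\<close> does not affect the integral.
\<close>

definition L2w :: "(real \<Rightarrow> real) \<Rightarrow> (real \<Rightarrow> real) set" where
  "L2w a = {u \<in> L2. set_integrable lebesgue I01 (\<lambda>x. (u x)\<^sup>2 / a x)}"

definition test_functions :: "(real \<Rightarrow> real) set" where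
  "test_functions =
     {\<phi>. (\<forall>n x. (deriv ^^ n) \<phi> differentiable (at x)) \<and>
         (\<exists>K. compact K \<and> K \<subseteq> I01 \<and> (\<forall>x. x \<notin> K \<longrightarrow> \<phi> x = 0))}"

text \<open>The \<open>k\<close>-th distributional derivative of \<open>u\<close> on (0,1) is the function \<open>g\<close>.\<close>

definition weak_deriv :: "nat \<Rightarrow> (real \<Rightarrow> real) \<Rightarrow> (real \<Rightarrow> real) \<Rightarrow> bool" where
  "weak_deriv k u g \<longleftrightarrow> u \<in> L1_loc \<and> g \<in> L1_loc \<and>
     (\<forall>\<phi>\<in>test_functions.
        (LINT x:I01|lebesgue. u x * (deriv ^^ k) \<phi> x) =
        (- 1) ^ k * (LINT x:I01|lebesgue. g x * \<phi> x))"

definition W1inf :: "(real \<Rightarrow> real) set" where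
  "W1inf = {u \<in> Linf. \<exists>u1\<in>Linf. weak_deriv 1 u u1}"

definition H2 :: "(real \<Rightarrow> real) set" where
  "H2 = {u \<in> L2. (\<exists>u1\<in>L2. weak_deriv 1 u u1) \<and> (\<exists>u2\<in>L2. weak_deriv 2 u u2)}"

text \<open>The continuous representative of \<open>f\<close> on [0,1] exists and takes the value \<open>c\<close> at \<open>x\<close>.\<close>

definition has_value :: "(real \<Rightarrow> real) \<Rightarrow> real \<Rightarrow> real \<Rightarrow> bool" where
  "has_value f x c \<longleftrightarrow> (\<exists>v. continuous_on {0..1} v \<and> ae_eq f v \<and> v x = c)"

text \<open>
  The continuous representative of \<open>f\<close> on [0,1] without the point \<open>x\<close> exists and tends to \<open>c\<close>
  at \<open>x\<close>; the limit is one-sided if \<open>x\<close> is an end point.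
\<close>

definition has_limit_value :: "(real \<Rightarrow> real) \<Rightarrow> real \<Rightarrow> real \<Rightarrow> bool" where
  "has_limit_value f x c \<longleftrightarrow>
     (\<exists>v. continuous_on ({0..1} - {x}) v \<and> ae_eq f v \<and> (v \<longlongrightarrow> c) (at x within {0..1}))"

definition H20 :: "(real \<Rightarrow> real) set" where
  "H20 = {u \<in> H2. \<forall>j\<in>{0, 1}. has_value u j 0 \<and> (\<exists>u1. weak_deriv 1 u u1 \<and> has_value u1 j 0)}"

definition H2w :: "(real \<Rightarrow> real) \<Rightarrow> (real \<Rightarrow> real) set" where
  "H2w a = L2w a \<inter> H20"

definition dom_A :: "(real \<Rightarrow> real) \<Rightarrow> (real \<Rightarrow> real) set" where
  "dom_A a = {u \<in> H2w a. \<exists>u4. weak_deriv 4 u u4 \<and> (\<lambda>x. a x * u4 x) \<in> L2w a}"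

definition dom_D :: "(real \<Rightarrow> real) \<Rightarrow> real \<Rightarrow> (real \<Rightarrow> real) set" where
  "dom_D a x0 =
     {u \<in> H2w a.
        (\<exists>u4. weak_deriv 4 u u4 \<and> (\<lambda>x. a x * u4 x) \<in> L2w a) \<and>
        has_value u x0 0 \<and>
        (\<exists>u1. weak_deriv 1 u u1 \<and> has_value (\<lambda>x. a x * u1 x) x0 0) \<and>
        (\<exists>u2. weak_deriv 2 u u2 \<and> has_limit_value (\<lambda>x. a x * u2 x) x0 0)}"

end

theory Submission
  imports Defs
begin

text \<open>
  The three conditions at \<open>x0\<close> are automatic. If the continuous representative of \<open>u\<close>
  did not vanish at \<open>x0\<close>, then \<open>u\<^sup>2 / a \<in> L\<^sup>1\<close> would force \<open>1 / a \<in> L\<^sup>1\<close>. As \<open>u'\<close> is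
  continuous, \<open>a u'\<close> vanishes where \<open>a\<close> does. For \<open>a u''\<close>, the bound \<open>(x - x0)\<^sup>2 \<le> C a\<close>
  gives \<open>(x - x0) u'''' \<in> L\<^sup>2\<close>, hence \<open>x (1 - x) u'''' \<in> L\<^sup>1\<close>, whether \<open>x0\<close> is an end
  point or not. So the Green potential of \<open>u''''\<close> is continuous on [0,1], and by the lemma of
  du Bois-Reymond it differs from \<open>- u''\<close> by an affine function: \<open>u''\<close> is continuous on all
  of [0,1], and \<open>a u''\<close> vanishes at \<open>x0\<close>.
\<close>

section \<open>Smooth functions and test functions\<close>

text \<open>The regularity half of \<open>test_functions\<close>, kept apart because the cutoffs are
  built from functions such as \<open>flat p\<close>, which need not have compact support.\<close>

definition smooth :: "(real \<Rightarrow> real) \<Rightarrow> bool" where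
  "smooth f \<longleftrightarrow> (\<forall>n x. (deriv ^^ n) f differentiable (at x))"

lemma deriv_eqI: "(\<And>x. (f has_real_derivative f' x) (at x)) \<Longrightarrow> deriv f = f'"
  by (auto simp: fun_eq_iff DERIV_imp_deriv)

text \<open>By induction every iterated derivative stays in \<open>S\<close>. A family closed under
  differentiation therefore consists of smooth functions, and no formula for the n-th derivative has
  to be found.\<close>

lemma smooth_coinduct:
  assumes "\<And>f. f \<in> S \<Longrightarrow> \<exists>f'\<in>S. \<forall>x. (f has_real_derivative f' x) (at x)" and "f \<in> S"
  shows "smooth f"
proof -
  have *: "(deriv ^^ n) f \<in> S" for n
  proof (induction n)
    case (Suc n)
    with assms(1) show ?case
      by (metis deriv_eqI funpow.simps(2) comp_apply)
  qed (simp add: assms(2))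
  then show ?thesis
    unfolding smooth_def using assms(1) by (metis real_differentiable_def)
qed

lemma smooth_DERIV: "smooth f \<Longrightarrow> (f has_real_derivative deriv f x) (at x)"
  unfolding smooth_def by (metis funpow_0 DERIV_deriv_iff_real_differentiable)

lemma smooth_deriv: "smooth f \<Longrightarrow> smooth (deriv f)"
  unfolding smooth_def by (metis funpow_Suc_right comp_apply)

lemma smooth_isCont: "smooth f \<Longrightarrow> isCont f x"
  using smooth_DERIV DERIV_isCont by blast

lemma smooth_primitive:
  assumes "\<And>x. (F has_real_derivative f x) (at x)" and "smooth f"
  shows "smooth F"
  unfolding smooth_def
proof (intro allI)
  fix n x
  show "(deriv ^^ n) F differentiable (at x)"
  proof (cases n)
    case 0
    then show ?thesis using assms(1) by (auto simp: real_differentiable_def)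
  next
    case (Suc m)
    then have "(deriv ^^ n) F = (deriv ^^ m) f"
      using deriv_eqI[OF assms(1)] by (simp add: funpow_Suc_right del: funpow.simps)
    then show ?thesis using assms(2) by (simp add: smooth_def)
  qed
qed

lemma smooth_const: "smooth (\<lambda>_. c)"
  by (rule smooth_coinduct[of "range (\<lambda>c _. c)"]) (auto intro!: exI[of _ 0])

text \<open>The product rule turns a product into a sum of products. The algebra generated by the
  smooth functions is closed under this, so \<open>smooth_coinduct\<close> settles sums and products
  at once.\<close>

inductive_set smooth_algebra :: "(real \<Rightarrow> real) set" where
  base: "smooth f \<Longrightarrow> f \<in> smooth_algebra"
| add: "f \<in> smooth_algebra \<Longrightarrow> g \<in> smooth_algebra \<Longrightarrow> (\<lambda>x. f x + g x) \<in> smooth_algebra"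
| mult: "f \<in> smooth_algebra \<Longrightarrow> g \<in> smooth_algebra \<Longrightarrow> (\<lambda>x. f x * g x) \<in> smooth_algebra"

lemma smooth_algebra_smooth:
  assumes "f \<in> smooth_algebra"
  shows "smooth f"
proof (rule smooth_coinduct[OF _ assms])
  fix f assume "f \<in> smooth_algebra"
  then show "\<exists>f'\<in>smooth_algebra. \<forall>x. (f has_real_derivative f' x) (at x)"
  proof induction
    case (base f)
    then show ?case using smooth_algebra.base smooth_DERIV smooth_deriv by blast
  next
    case (add f g)
    then obtain f' g' where "f' \<in> smooth_algebra" "g' \<in> smooth_algebra"
      "\<forall>x. (f has_real_derivative f' x) (at x)" "\<forall>x. (g has_real_derivative g' x) (at x)" by blast
    then show ?case
      by (intro bexI[of _ "\<lambda>x. f' x + g' x"]) (auto intro: smooth_algebra.add DERIV_add)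
  next
    case (mult f g)
    then obtain f' g' where "f' \<in> smooth_algebra" "g' \<in> smooth_algebra"
      "\<forall>x. (f has_real_derivative f' x) (at x)" "\<forall>x. (g has_real_derivative g' x) (at x)" by blast
    with mult(1,2) show ?case
      by (intro bexI[of _ "\<lambda>x. f' x * g x + g' x * f x"])
        (auto intro: smooth_algebra.intros DERIV_mult)
  qed
qed

lemma smooth_add: "smooth f \<Longrightarrow> smooth g \<Longrightarrow> smooth (\<lambda>x. f x + g x)"
  by (blast intro: smooth_algebra.intros smooth_algebra_smooth)

lemma smooth_mult: "smooth f \<Longrightarrow> smooth g \<Longrightarrow> smooth (\<lambda>x. f x * g x)"
  by (blast intro: smooth_algebra.intros smooth_algebra_smooth)

lemma smooth_affine:
  assumes "smooth f"
  shows "smooth (\<lambda>x. f (k * x + b))"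
\<comment> \<open>Each use of the chain rule contributes a factor \<open>k\<close>; the scalar
  \<open>c\<close> in the family absorbs it.\<close>
proof (rule smooth_coinduct[of "{\<lambda>x. c * g (k * x + b) | c g. smooth g}"])
  show "(\<lambda>x. f (k * x + b)) \<in> {\<lambda>x. c * g (k * x + b) | c g. smooth g}"
    using assms by (auto intro!: exI[of _ 1])
next
  fix h assume "h \<in> {\<lambda>x. c * g (k * x + b) | c g. smooth g}"
  then obtain c g where h: "h = (\<lambda>x. c * g (k * x + b))" and g: "smooth g" by auto
  have "(h has_real_derivative (c * k) * deriv g (k * x + b)) (at x)" for x
    unfolding h
    by (rule derivative_eq_intros DERIV_chain2[of g, OF smooth_DERIV[OF g]] refl | simp)+
  moreover have "(\<lambda>x. (c * k) * deriv g (k * x + b)) \<in> {\<lambda>x. c * g (k * x + b) | c g. smooth g}"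
    using smooth_deriv[OF g] by blast
  ultimately show "\<exists>h'\<in>{\<lambda>x. c * g (k * x + b) | c g. smooth g}. \<forall>x. (h has_real_derivative h' x) (at x)"
    by (intro bexI[of _ "\<lambda>x. (c * k) * deriv g (k * x + b)"] allI)
qed

text \<open>The functions \<open>flat p\<close> are closed under differentiation, so they are all smooth.\<close>

definition flat :: "real poly \<Rightarrow> real \<Rightarrow> real" where
  "flat p t = (if t > 0 then poly p (1 / t) * exp (- (1 / t)) else 0)"

text \<open>Exponential decay beats each monomial. With y = 1 / t this governs \<open>flat p\<close>
  as t decreases to 0.\<close>

lemma poly_exp_tendsto_0: "((\<lambda>y. poly p y * exp (- y)) \<longlongrightarrow> (0::real)) at_top"
proof -
  have "((\<lambda>y. \<Sum>i\<le>degree p. coeff p i * (y ^ i / exp y)) \<longlongrightarrow> (\<Sum>i\<le>degree p. coeff p i * 0)) at_top"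
    by (intro tendsto_intros tendsto_power_div_exp_0)
  then show ?thesis
    by (simp add: poly_altdef sum_distrib_right exp_minus divide_inverse mult.assoc)
qed

text \<open>With s = 1 / t the derivative in t is -s^2 times that in s, so p(s) exp(-s) becomes s^2
  (p(s) - p'(s)) exp(-s); \<open>[:0, 0, 1:]\<close> is the factor s^2. At 0 both one-sided
  difference quotients tend to 0.\<close>

lemma flat_DERIV: "(flat p has_real_derivative flat ((p - pderiv p) * [:0, 0, 1:]) t) (at t)"
proof -
  consider "t > 0" | "t < 0" | "t = 0" by linarith
  then show ?thesis
  proof cases
    case 1
    have "((\<lambda>t. poly p (1 / t) * exp (- (1 / t))) has_real_derivative
        flat ((p - pderiv p) * [:0, 0, 1:]) t) (at t)"
      using 1 unfolding flat_def
      by (auto intro!: derivative_eq_intros DERIV_chain2[OF poly_DERIV] simp: field_simps power2_eq_square)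
    then show ?thesis
      by (rule has_field_derivative_transform_within_open[where S = "{0<..}"])
        (use 1 in \<open>auto simp: flat_def\<close>)
  next
    case 2
    have "((\<lambda>_. 0) has_real_derivative flat ((p - pderiv p) * [:0, 0, 1:]) t) (at t)"
      using 2 by (simp add: flat_def)
    then show ?thesis
      by (rule has_field_derivative_transform_within_open[where S = "{..<0}"])
        (use 2 in \<open>auto simp: flat_def\<close>)
  next
    case 3
    \<comment> \<open>The difference quotient at 0 divides by \<open>t\<close>, which multiplies the
      polynomial in 1 / t by its variable.\<close>
    have "((\<lambda>t. poly (p * [:0, 1:]) (inverse t) * exp (- inverse t)) \<longlongrightarrow> 0) (at_right 0)"
      by (rule filterlim_compose[OF poly_exp_tendsto_0 filterlim_inverse_at_top_right])
    then have "((\<lambda>t. flat p t / t) \<longlongrightarrow> 0) (at_right 0)"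
      by (rule Lim_transform_eventually)
        (auto simp: eventually_at_right_field flat_def field_simps intro!: exI[of _ 1])
    moreover have "((\<lambda>t. flat p t / t) \<longlongrightarrow> 0) (at_left 0)"
      by (rule tendsto_eventually)
        (auto simp: eventually_at_left_field flat_def intro!: exI[of _ "-1"])
    ultimately show ?thesis
      using 3 by (simp add: has_field_derivative_iff filterlim_split_at flat_def)
  qed
qed

lemma smooth_flat: "smooth (flat p)"
  by (rule smooth_coinduct[of "range flat"]) (use flat_DERIV in blast)+

section \<open>Test functions and their supports\<close>

lemma test_function_iff:
  "\<phi> \<in> test_functions \<longleftrightarrow> smooth \<phi> \<and> (\<exists>c d. 0 < c \<and> c < d \<and> d < 1 \<and> (\<forall>x. x \<notin> {c..d} \<longrightarrow> \<phi> x = 0))"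
proof
  assume "\<phi> \<in> test_functions"
  then obtain K where s: "smooth \<phi>" and K: "compact K" "K \<subseteq> I01" "\<forall>x. x \<notin> K \<longrightarrow> \<phi> x = 0"
    by (auto simp: test_functions_def smooth_def)
  \<comment> \<open>The extra point 1/2 makes the set nonempty, so that its minimum and maximum
    exist.\<close>
  have "compact (insert (1/2) K)" using K(1) by simp
  then obtain c d where cd: "c \<in> insert (1/2) K" "d \<in> insert (1/2) K"
    "\<forall>x\<in>insert (1/2) K. c \<le> x \<and> x \<le> d"
    by (metis compact_attains_inf compact_attains_sup insert_not_empty)
  then have "0 < c" "d < 1" "c \<le> 1/2" "1/2 \<le> d" using K(2) by auto
  \<comment> \<open>Moving both ends outward makes the inequality between them strict even if the
    set is a single point.\<close>
  moreover from this have "\<phi> x = 0" if "x \<notin> {c/2..(d+1)/2}" for x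
    using that cd(3) K(3) by (cases "x \<in> K") force+
  ultimately show "smooth \<phi> \<and> (\<exists>c d. 0 < c \<and> c < d \<and> d < 1 \<and> (\<forall>x. x \<notin> {c..d} \<longrightarrow> \<phi> x = 0))"
    using s by (intro conjI exI[of _ "c/2"] exI[of _ "(d+1)/2"]) auto
next
  assume "smooth \<phi> \<and> (\<exists>c d. 0 < c \<and> c < d \<and> d < 1 \<and> (\<forall>x. x \<notin> {c..d} \<longrightarrow> \<phi> x = 0))"
  then obtain c d where "smooth \<phi>" "0 < c" "d < 1" "\<forall>x. x \<notin> {c..d} \<longrightarrow> \<phi> x = 0" by blast
  then show "\<phi> \<in> test_functions"
    unfolding test_functions_def smooth_def by (auto intro!: exI[of _ "{c..d}"])
qed

lemma test_function_smooth: "\<phi> \<in> test_functions \<Longrightarrow> smooth \<phi>"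
  by (simp add: test_function_iff)

lemma test_function_eq_0: "\<phi> \<in> test_functions \<Longrightarrow> x \<notin> I01 \<Longrightarrow> \<phi> x = 0"
  unfolding test_functions_def by blast

lemma test_function_add_cmult:
  assumes "\<phi> \<in> test_functions" "\<psi> \<in> test_functions"
  shows "(\<lambda>x. \<phi> x + k * \<psi> x) \<in> test_functions"
proof -
  obtain K L where "compact K" "K \<subseteq> I01" "\<forall>x. x \<notin> K \<longrightarrow> \<phi> x = 0"
    "compact L" "L \<subseteq> I01" "\<forall>x. x \<notin> L \<longrightarrow> \<psi> x = 0"
    using assms unfolding test_functions_def by blast
  then have "\<exists>K. compact K \<and> K \<subseteq> I01 \<and> (\<forall>x. x \<notin> K \<longrightarrow> \<phi> x + k * \<psi> x = 0)"
    by (intro exI[of _ "K \<union> L"]) (simp add: compact_Un)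
  moreover have "smooth (\<lambda>x. \<phi> x + k * \<psi> x)"
    using assms[THEN test_function_smooth] by (intro smooth_add smooth_mult smooth_const)
  ultimately show ?thesis by (simp add: test_functions_def smooth_def)
qed

lemma test_function_deriv:
  assumes "\<phi> \<in> test_functions"
  shows "deriv \<phi> \<in> test_functions"
proof -
  obtain c d where cd: "0 < c" "c < d" "d < 1" "\<forall>x. x \<notin> {c..d} \<longrightarrow> \<phi> x = 0"
    using assms unfolding test_function_iff by blast
  have "deriv \<phi> x = 0" if "x \<notin> {c..d}" for x
  proof -
    have "open (- {c..d})" by auto
    then have "eventually (\<lambda>y. y \<in> - {c..d}) (nhds x)"
      using that by (intro eventually_nhds_in_open) auto
    then have "eventually (\<lambda>y. \<phi> y = 0) (nhds x)"
      by (rule eventually_mono) (use cd in auto)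
    then have "deriv \<phi> x = deriv (\<lambda>_. 0) x" by (rule deriv_cong_ev) simp
    then show ?thesis by simp
  qed
  then show ?thesis
    using cd test_function_smooth[OF assms, THEN smooth_deriv] by (auto simp: test_function_iff)
qed

lemma test_function_bounded:
  assumes "\<phi> \<in> test_functions"
  obtains B where "\<And>x. \<bar>\<phi> x\<bar> \<le> B"
proof -
  obtain K where K: "compact K" "\<forall>x. x \<notin> K \<longrightarrow> \<phi> x = 0"
    using assms unfolding test_functions_def by blast
  have "compact (\<phi> ` K)"
    using K(1) smooth_isCont[OF test_function_smooth[OF assms]]
    by (intro compact_continuous_image continuous_at_imp_continuous_on) auto
  then obtain B where "\<forall>x\<in>K. \<bar>\<phi> x\<bar> \<le> B"
    by (meson bounded_real compact_imp_bounded imageI)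
  then have "\<bar>\<phi> x\<bar> \<le> max B 0" for x
    using K(2) by (cases "x \<in> K") (auto simp: le_max_iff_disj)
  then show ?thesis using that by blast
qed

lemma test_function_measurable [measurable_dest]:
  "\<phi> \<in> test_functions \<Longrightarrow> \<phi> \<in> borel_measurable borel"
  by (intro borel_measurable_continuous_onI continuous_at_imp_continuous_on)
    (auto intro: smooth_isCont test_function_smooth)

section \<open>The lemmas of du Bois-Reymond\<close>

text \<open>\<open>\<phi>\<close> is bounded and supported in a compact set, on which
  \<open>f\<close> is integrable. This justifies splitting test integrals into sums later
  on.\<close>

lemma L1_loc_mult_test_function:
  assumes "f \<in> L1_loc" "\<phi> \<in> test_functions"
  shows "set_integrable lebesgue I01 (\<lambda>x. f x * \<phi> x)"
proof -
  obtain K where K: "compact K" "K \<subseteq> I01" "\<forall>x. x \<notin> K \<longrightarrow> \<phi> x = 0"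
    using assms(2) unfolding test_functions_def by blast
  obtain B where B: "\<And>x. \<bar>\<phi> x\<bar> \<le> B"
    using test_function_bounded[OF assms(2)] by blast
  have f: "integrable lebesgue (\<lambda>x. indicator K x * f x)"
    using assms(1) K by (auto simp: L1_loc_def set_integrable_def)
  have [measurable]: "\<phi> \<in> borel_measurable lebesgue"
    using test_function_measurable[OF assms(2)] by (simp add: measurable_completion)
  have "integrable lebesgue (\<lambda>x. (indicator K x * f x) * \<phi> x)"
  proof (rule Bochner_Integration.integrable_bound)
    show "integrable lebesgue (\<lambda>x. B * (indicator K x * f x))"
      using f by simp
    show "(\<lambda>x. (indicator K x * f x) * \<phi> x) \<in> borel_measurable lebesgue"
      using borel_measurable_integrable[OF f] by measurable
    show "AE x in lebesgue. norm (indicator K x * f x * \<phi> x) \<le> norm (B * (indicator K x * f x))"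
    proof (intro AE_I2)
      fix x
      have "\<bar>\<phi> x\<bar> \<le> \<bar>B\<bar>" using B[of x] by linarith
      then show "norm (indicator K x * f x * \<phi> x) \<le> norm (B * (indicator K x * f x))"
        by (simp add: abs_mult mult_right_mono mult.commute)
    qed
  qed
  also have "(\<lambda>x. (indicator K x * f x) * \<phi> x) = (\<lambda>x. indicator I01 x *\<^sub>R (f x * \<phi> x))"
    using K by (force simp: indicator_def fun_eq_iff)
  finally show ?thesis by (simp add: set_integrable_def)
qed

lemma set_integrable_I01_L1_loc:
  assumes "set_integrable lebesgue I01 f"
  shows "f \<in> L1_loc"
  unfolding L1_loc_def
  by (auto intro!: set_integrable_subset[OF assms] dest: borel_compact)

lemma continuous_set_integrable_I01:
  fixes f :: "real \<Rightarrow> real"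
  assumes "continuous_on {0..1} f"
  shows "set_integrable lebesgue I01 f"
  using absolutely_integrable_continuous_real[OF assms]
  by (rule set_integrable_subset) auto

lemma set_integral_FTC:
  fixes F f :: "real \<Rightarrow> real"
  assumes "\<And>x. (F has_real_derivative f x) (at x)" and "continuous_on {0..1} f"
  shows "(LINT x:I01|lebesgue. f x) = F 1 - F 0"
proof -
  have "(f has_integral F 1 - F 0) {0..1}"
    using assms(1)
    by (intro fundamental_theorem_of_calculus)
      (auto simp: has_real_derivative_iff_has_vector_derivative[symmetric] intro: has_field_derivative_at_within)
  then have "(f has_integral F 1 - F 0) I01"
    by (simp add: has_integral_Icc_iff_Ioo)
  then show ?thesis
    using set_lebesgue_integral_eq_integral(2)[OF continuous_set_integrable_I01[OF assms(2)]]
    by (simp add: integral_unique)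
qed

lemma smooth_continuous_on: "smooth f \<Longrightarrow> continuous_on A f"
  by (simp add: smooth_isCont continuous_at_imp_continuous_on)

text \<open>An antiderivative is constant on each side of the support. Zero mean makes the two
  constants equal, and subtracting the common value gives compact support.\<close>

lemma test_function_primitive:
  assumes \<psi>: "\<psi> \<in> test_functions" and 0: "(LINT x:I01|lebesgue. \<psi> x) = 0"
  obtains \<phi> where "\<phi> \<in> test_functions" "deriv \<phi> = \<psi>"
proof -
  obtain c d where cd: "0 < c" "c < d" "d < 1" "\<forall>x. x \<notin> {c..d} \<longrightarrow> \<psi> x = 0"
    and s: "smooth \<psi>" using \<psi> unfolding test_function_iff by blast
  have "\<exists>F. \<forall>x. (-\<infinity>::ereal) < ereal x \<longrightarrow> ereal x < \<infinity> \<longrightarrow> (F has_vector_derivative \<psi> x) (at x)"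
    using einterval_antiderivative[of "-\<infinity>" "\<infinity>" \<psi>] smooth_isCont[OF s] by auto
  then obtain F where F: "\<And>x. (F has_real_derivative \<psi> x) (at x)"
    by (auto simp: has_real_derivative_iff_has_vector_derivative)
  define \<phi> where "\<phi> = (\<lambda>x. F x - F 0)"
  have d: "(\<phi> has_real_derivative \<psi> x) (at x)" for x
    unfolding \<phi>_def using DERIV_diff[OF F DERIV_const] by simp
  have "F 1 = F 0"
    using set_integral_FTC[OF F smooth_continuous_on[OF s]] 0 by simp
  have low: "F x = F 0" if "x < c" for x
  proof -
    have "(F has_real_derivative 0) (at y within {..<c})" if "y \<in> {..<c}" for y
      using has_field_derivative_at_within[OF F[of y], of "{..<c}"] cd(4) that by simp
    then have "\<exists>k. \<forall>y\<in>{..<c}. F y = k"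
      by (intro has_field_derivative_zero_constant) auto
    then show ?thesis using that cd(1) by auto
  qed
  have high: "F x = F 0" if "x > d" for x
  proof -
    have "(F has_real_derivative 0) (at y within {d<..})" if "y \<in> {d<..}" for y
      using has_field_derivative_at_within[OF F[of y], of "{d<..}"] cd(4) that by simp
    then have "\<exists>k. \<forall>y\<in>{d<..}. F y = k"
      by (intro has_field_derivative_zero_constant) auto
    then show ?thesis using that cd(3) \<open>F 1 = F 0\<close> by auto
  qed
  have "\<phi> x = 0" if "x \<notin> {c..d}" for x
    using that low[of x] high[of x] by (cases "x < c") (simp_all add: \<phi>_def)
  then have "\<phi> \<in> test_functions"
    unfolding test_function_iff using smooth_primitive[OF d s] cd(1-3) by blast
  then show ?thesis using that deriv_eqI[OF d] by blast
qed

section \<open>The fundamental lemma of the calculus of variations\<close>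

lemma interval_cutoff:
  assumes "0 < c" "c < d" "d < 1"
  obtains \<psi> :: "nat \<Rightarrow> real \<Rightarrow> real" where
    "\<And>n. \<psi> n \<in> test_functions" "\<And>n x. \<bar>\<psi> n x\<bar> \<le> indicator {c<..<d} x"
    "\<And>x. (\<lambda>n. \<psi> n x) \<longlonglongrightarrow> indicator {c<..<d} x"
proof
  \<comment> \<open>For t > 0 the value of \<open>flat 1\<close> is exp(-1/t). Dilation by
    \<open>Suc n\<close> divides the exponents by \<open>Suc n\<close>, so on (c,d) the product
    tends to 1, while it is 0 elsewhere for every \<open>n\<close>. The arguments are expanded to
    fit \<open>smooth_affine\<close>.\<close>
  define \<psi> :: "nat \<Rightarrow> real \<Rightarrow> real" where
    "\<psi> = (\<lambda>n x. flat 1 (real (Suc n) * x + - real (Suc n) * c) * flat 1 (- real (Suc n) * x + real (Suc n) * d))"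
  have pos: "(0 < real (Suc n) * x + - real (Suc n) * c) = (c < x)"
    "(0 < - real (Suc n) * x + real (Suc n) * d) = (x < d)" for n x
  proof -
    have "real (Suc n) * x + - real (Suc n) * c = real (Suc n) * (x - c)"
      "- real (Suc n) * x + real (Suc n) * d = real (Suc n) * (d - x)" by (simp_all add: algebra_simps)
    then show "(0 < real (Suc n) * x + - real (Suc n) * c) = (c < x)"
      "(0 < - real (Suc n) * x + real (Suc n) * d) = (x < d)"
      by (simp_all only: zero_less_mult_iff) auto
  qed
  have eq: "\<psi> n x = indicator {c<..<d} x * (exp (- (1 / (x - c)) * inverse (real (Suc n))) * exp (- (1 / (d - x)) * inverse (real (Suc n))))" for n x
  proof -
    have "real (Suc n) * x + - real (Suc n) * c = real (Suc n) * (x - c)"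
      "- real (Suc n) * x + real (Suc n) * d = real (Suc n) * (d - x)" by (simp_all add: algebra_simps)
    then show ?thesis
      unfolding \<psi>_def flat_def pos by (simp add: indicator_def divide_inverse mult.commute)
  qed
  show "\<psi> n \<in> test_functions" for n
  proof -
    have "smooth (\<psi> n)"
      unfolding \<psi>_def by (intro smooth_mult smooth_affine smooth_flat)
    moreover have "\<psi> n x = 0" if "x \<notin> {c..d}" for x
      using that by (auto simp: eq indicator_def)
    ultimately show ?thesis
      using assms by (auto simp: test_function_iff)
  qed
  show "\<bar>\<psi> n x\<bar> \<le> indicator {c<..<d} x" for n x
  proof -
    have "\<bar>exp (- (1 / (x - c)) * inverse (real (Suc n))) * exp (- (1 / (d - x)) * inverse (real (Suc n)))\<bar> \<le> 1"
      if "c < x" "x < d"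
      unfolding abs_mult abs_exp_cancel
      using that by (intro mult_le_one exp_ge_zero) (simp_all add: divide_nonneg_pos)
    then show ?thesis by (simp add: eq indicator_def)
  qed
  show "(\<lambda>n. \<psi> n x) \<longlonglongrightarrow> indicator {c<..<d} x" for x
  proof -
    have "(\<lambda>n. \<psi> n x) \<longlonglongrightarrow> indicator {c<..<d} x * (exp (- (1 / (x - c)) * 0) * exp (- (1 / (d - x)) * 0))"
      unfolding eq by (intro tendsto_intros LIMSEQ_inverse_real_of_nat)
    then show ?thesis by simp
  qed
qed

text \<open>The positive and negative parts of \<open>g\<close> are densities of two finite
  measures. These agree on all rays, hence everywhere, so the parts agree almost everywhere. As at
  most one of them is nonzero at each point, both vanish.\<close>

lemma AE_zero_if_integral_greaterThan_zero:
  fixes g :: "real \<Rightarrow> real"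
  assumes g: "integrable lborel g" and 0: "\<And>x. (LINT y:{x<..}|lborel. g y) = 0"
  shows "AE x in lborel. g x = 0"
proof -
  have [measurable]: "g \<in> borel_measurable borel" using g by auto
  \<comment> \<open>\<open>ennreal\<close> sends negative numbers to 0, so the densities of
    \<open>M\<close> and \<open>N\<close> are the positive and the negative part of
    \<open>g\<close>.\<close>
  define M where "M = density lborel (\<lambda>x. ennreal (g x))"
  define N where "N = density lborel (\<lambda>x. ennreal (- g x))"
  have fin: "(\<integral>\<^sup>+ x. ennreal (g x) \<partial>lborel) \<noteq> \<infinity>" "(\<integral>\<^sup>+ x. ennreal (- g x) \<partial>lborel) \<noteq> \<infinity>"
    using g by (auto simp: real_integrable_def)
  have e: "emeasure M {x<..} < \<infinity>" "emeasure M {x<..} = emeasure N {x<..}" for x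
  proof -
    define h where "h = (\<lambda>y. indicator {x<..} y * g y)"
    have h: "integrable lborel h"
      unfolding h_def using integrable_mult_indicator[OF _ g, of "{x<..}"] by simp
    have M: "emeasure M {x<..} = (\<integral>\<^sup>+ y. ennreal (h y) \<partial>lborel)"
      and N: "emeasure N {x<..} = (\<integral>\<^sup>+ y. ennreal (- h y) \<partial>lborel)"
      unfolding M_def N_def h_def
      by (auto simp: emeasure_density indicator_def intro!: nn_integral_cong)
    have fin': "(\<integral>\<^sup>+ y. ennreal (h y) \<partial>lborel) \<noteq> \<infinity>" "(\<integral>\<^sup>+ y. ennreal (- h y) \<partial>lborel) \<noteq> \<infinity>"
      using h by (auto simp: real_integrable_def)
    have "integral\<^sup>L lborel h = 0"
      using 0[of x] by (simp add: h_def set_lebesgue_integral_def)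
    then have "enn2real (\<integral>\<^sup>+ y. ennreal (h y) \<partial>lborel) = enn2real (\<integral>\<^sup>+ y. ennreal (- h y) \<partial>lborel)"
      using real_lebesgue_integral_def[OF h] by simp
    then show "emeasure M {x<..} = emeasure N {x<..}"
      unfolding M N using fin' by (metis ennreal_enn2real_if infinity_ennreal_def)
    show "emeasure M {x<..} < \<infinity>"
      unfolding M using fin' by (simp add: less_top)
  qed
  have "M = N"
    by (rule measure_eqI_lessThan) (use e in \<open>auto simp: M_def N_def\<close>)
  then have "AE x in lborel. ennreal (g x) = ennreal (- g x)"
    unfolding M_def N_def using fin by (subst (asm) finite_density_unique) auto
  then show ?thesis
  proof eventually_elim
    fix x assume "ennreal (g x) = ennreal (- g x)"
    then show "g x = 0"
      by (cases "g x" "0 :: real" rule: linorder_cases) (auto simp: ennreal_neg ennreal_eq_0_iff)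
  qed
qed

text \<open>Testing with smooth cutoffs shows that \<open>g\<close> has zero integral over every
  interval compactly inside (0,1). The criterion with rays then applies to \<open>g\<close> cut off
  to such an interval, and countably many of them exhaust (0,1).\<close>

lemma L1_loc_AE_zero:
  assumes g: "g \<in> L1_loc" and 0: "\<And>\<phi>. \<phi> \<in> test_functions \<Longrightarrow> (LINT x:I01|lebesgue. g x * \<phi> x) = 0"
  shows "AE x in lebesgue. x \<in> I01 \<longrightarrow> g x = 0"
proof -
  have Kint: "integrable lebesgue (\<lambda>x. indicator {c<..<d} x * g x)" if "0 < c" "d < 1" for c d
  proof -
    have "set_integrable lebesgue {c..d} g"
      using g that unfolding L1_loc_def by (auto dest: spec[of _ "{c..d}"])
    then have "set_integrable lebesgue {c<..<d} g"
      by (rule set_integrable_subset) auto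
    then show ?thesis by (simp add: set_integrable_def)
  qed
  have Iz: "(LINT x|lebesgue. indicator {c<..<d} x * g x) = 0" if cd: "0 < c" "c < d" "d < 1" for c d
  proof -
    obtain \<psi> where \<psi>: "\<And>n. \<psi> n \<in> test_functions" "\<And>n x. \<bar>\<psi> n x\<bar> \<le> indicator {c<..<d} x"
      "\<And>x. (\<lambda>n. \<psi> n x) \<longlonglongrightarrow> indicator {c<..<d} x"
      using interval_cutoff[OF cd] by blast
    have eq: "indicator I01 x *\<^sub>R (g x * \<psi> n x) = (indicator {c<..<d} x * g x) * \<psi> n x" for n x
      using \<psi>(2)[of n x] cd by (auto simp: indicator_def split: if_splits)
    note [measurable] = borel_measurable_integrable[OF Kint[OF cd(1,3)]]
    have [measurable]: "\<psi> n \<in> borel_measurable lebesgue" for n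
      using test_function_measurable[OF \<psi>(1)] by (simp add: measurable_completion)
    have "(\<lambda>n. LINT x|lebesgue. (indicator {c<..<d} x * g x) * \<psi> n x) \<longlonglongrightarrow>
        (LINT x|lebesgue. indicator {c<..<d} x * g x)"
    proof (rule integral_dominated_convergence)
      show "integrable lebesgue (\<lambda>x. \<bar>indicator {c<..<d} x * g x\<bar>)"
        using Kint[OF cd(1,3)] by simp
      show "AE x in lebesgue. (\<lambda>n. (indicator {c<..<d} x * g x) * \<psi> n x) \<longlonglongrightarrow> indicator {c<..<d} x * g x"
      proof (intro AE_I2)
        fix x
        have "(\<lambda>n. (indicator {c<..<d} x * g x) * \<psi> n x) \<longlonglongrightarrow> (indicator {c<..<d} x * g x) * indicator {c<..<d} x"
          by (intro tendsto_intros \<psi>(3))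
        then show "(\<lambda>n. (indicator {c<..<d} x * g x) * \<psi> n x) \<longlonglongrightarrow> indicator {c<..<d} x * g x"
          by (cases "x \<in> {c<..<d}") simp_all
      qed
      show "AE x in lebesgue. norm ((indicator {c<..<d} x * g x) * \<psi> n x) \<le> \<bar>indicator {c<..<d} x * g x\<bar>" for n
      proof (intro AE_I2)
        fix x
        have "\<bar>\<psi> n x\<bar> \<le> 1"
          using \<psi>(2)[of n x] by (rule order_trans) (simp add: indicator_def)
        then show "norm ((indicator {c<..<d} x * g x) * \<psi> n x) \<le> \<bar>indicator {c<..<d} x * g x\<bar>"
          unfolding real_norm_def abs_mult[of _ "\<psi> n x"] by (intro mult_left_le) auto
      qed
    qed auto
    moreover have "(LINT x|lebesgue. (indicator {c<..<d} x * g x) * \<psi> n x) = 0" for n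
      using 0[OF \<psi>(1)[of n]] unfolding set_lebesgue_integral_def eq .
    ultimately show ?thesis by (simp add: LIMSEQ_const_iff)
  qed
  have AE: "AE x in lebesgue. x \<in> {c<..<d} \<longrightarrow> g x = 0" if cd: "0 < c" "c < d" "d < 1" for c d
  proof -
    let ?g = "\<lambda>x. indicator {c<..<d} x * g x"
    have mg: "?g \<in> borel_measurable lebesgue"
      using Kint[OF cd(1,3)] by auto
    \<comment> \<open>\<open>?g\<close> is only known to be Lebesgue measurable, whereas the
      criterion with rays is stated for \<open>lborel\<close>; \<open>h\<close> is a Borel
      representative.\<close>
    then obtain h where h[measurable]: "h \<in> borel_measurable lborel" and hg: "AE x in lborel. ?g x = h x"
      using completion_ex_borel_measurable_real[of ?g lborel] by auto
    have hg': "AE x in lebesgue. ?g x = h x"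
      using hg by (rule AE_completion)
    have mh: "h \<in> borel_measurable lebesgue" using h by (simp add: measurable_completion)
    have "integrable lebesgue h"
      using Kint[OF cd(1,3)] integrable_cong_AE[OF mg mh hg'] by simp
    then have hi: "integrable lborel h"
      using integrable_completion[of h lborel] h by simp
    have "(LINT y:{x<..}|lborel. h y) = 0" for x
    proof -
      have "(LINT y:{x<..}|lborel. h y) = (LINT y|lebesgue. indicator {x<..} y * h y)"
        using h by (simp add: set_lebesgue_integral_def integral_completion)
      also have "\<dots> = (LINT y|lebesgue. indicator {x<..} y * ?g y)"
      proof (intro integral_cong_AE)
        have ind: "(indicator {x<..} :: real \<Rightarrow> real) \<in> borel_measurable lebesgue"
          by (rule borel_measurable_indicator) simp
        show "(\<lambda>y. indicator {x<..} y * h y) \<in> borel_measurable lebesgue"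
          "(\<lambda>y. indicator {x<..} y * ?g y) \<in> borel_measurable lebesgue"
          by (rule borel_measurable_times[OF ind mh], rule borel_measurable_times[OF ind mg])
      qed (use hg' in auto)
      \<comment> \<open>A ray cuts (c,d) in an interval of the same kind or in the empty
        set.\<close>
      also have "\<dots> = (LINT y|lebesgue. indicator {max x c<..<d} y * g y)"
        by (intro Bochner_Integration.integral_cong) (auto simp: indicator_def)
      also have "\<dots> = 0"
        using Iz[of "max x c" d] cd by (cases "max x c < d") auto
      finally show ?thesis .
    qed
    then have "AE x in lborel. h x = 0"
      by (rule AE_zero_if_integral_greaterThan_zero[OF hi])
    then have "AE x in lebesgue. h x = 0" by (rule AE_completion)
    with hg' show ?thesis by eventually_elim (auto simp: indicator_def)
  qed
  \<comment> \<open>Starting at 3 gives a nonempty interval for every \<open>n\<close>, as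
    \<open>AE\<close> asks for \<open>c < d\<close>.\<close>
  have "AE x in lebesgue. \<forall>n. x \<in> {1 / real (n + 3)<..<1 - 1 / real (n + 3)} \<longrightarrow> g x = 0"
    unfolding AE_all_countable by (intro allI AE) (auto simp: field_simps)
  then show ?thesis
  proof eventually_elim
    fix x assume *: "\<forall>n. x \<in> {1 / real (n + 3)<..<1 - 1 / real (n + 3)} \<longrightarrow> g x = 0"
    show "x \<in> I01 \<longrightarrow> g x = 0"
    proof
      assume "x \<in> I01"
      then have "0 < min x (1 - x)" by auto
      then obtain n where n: "inverse (real (Suc n)) < min x (1 - x)"
        using reals_Archimedean by blast
      moreover have "1 / real (n + 3) \<le> inverse (real (Suc n))" by (simp add: field_simps)
      ultimately have "x \<in> {1 / real (n + 3)<..<1 - 1 / real (n + 3)}" by auto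
      with * show "g x = 0" by blast
    qed
  qed
qed

section \<open>Functions whose first or second distributional derivative vanishes\<close>

lemma normalized_test_function:
  obtains b where "b \<in> test_functions" "(LINT x:I01|lebesgue. b x) = 1"
proof -
  have "\<exists>b\<in>test_functions. (LINT x:I01|lebesgue. b x) \<noteq> 0"
  \<comment> \<open>If all test functions had integral 0, the fundamental lemma for the constant 1
    would give 1 = 0 almost everywhere on (0,1). This spares the integration of an explicit
    bump.\<close>
  proof (rule ccontr)
    assume "\<not> ?thesis"
    then have "AE x in lebesgue. x \<in> I01 \<longrightarrow> (1::real) = 0"
      by (intro L1_loc_AE_zero set_integrable_I01_L1_loc continuous_set_integrable_I01) auto
    then have "AE x in lebesgue. x \<notin> I01" by simp
    then have "emeasure lebesgue I01 = 0"
      by (subst (asm) AE_iff_measurable[where N = I01]) auto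
    then show False by simp
  qed
  then obtain b where b: "b \<in> test_functions" and n: "(LINT x:I01|lebesgue. b x) \<noteq> 0" by blast
  show ?thesis
  proof
    show "(\<lambda>x. 0 + inverse (LINT x:I01|lebesgue. b x) * b x) \<in> test_functions"
      by (rule test_function_add_cmult[OF _ b])
        (use smooth_const[of 0] in \<open>auto simp: test_functions_def smooth_def intro: exI[of _ "{}"]\<close>)
    show "(LINT x:I01|lebesgue. 0 + inverse (LINT x:I01|lebesgue. b x) * b x) = 1"
      using n by simp
  qed
qed

lemma set_integral_test_function_deriv:
  assumes "\<phi> \<in> test_functions"
  shows "(LINT x:I01|lebesgue. deriv \<phi> x) = 0"
proof -
  have s: "smooth \<phi>" by (rule test_function_smooth[OF assms])
  have "(LINT x:I01|lebesgue. deriv \<phi> x) = \<phi> 1 - \<phi> 0"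
    by (rule set_integral_FTC[OF smooth_DERIV[OF s] smooth_continuous_on[OF smooth_deriv[OF s]]])
  then show ?thesis by (simp add: test_function_eq_0[OF assms])
qed

text \<open>Integration by parts without boundary terms. It evaluates the linear correction in
  \<open>du_Bois_Reymond2\<close>.\<close>

lemma set_integral_id_mult_deriv:
  assumes "\<phi> \<in> test_functions"
  shows "(LINT x:I01|lebesgue. x * deriv \<phi> x) = - (LINT x:I01|lebesgue. \<phi> x)"
proof -
  have s: "smooth \<phi>" by (rule test_function_smooth[OF assms])
  note c = smooth_continuous_on[OF s] smooth_continuous_on[OF smooth_deriv[OF s]]
  have "((\<lambda>x. x * \<phi> x) has_real_derivative (x * deriv \<phi> x + \<phi> x)) (at x)" for x
    by (auto intro!: derivative_eq_intros smooth_DERIV[OF s])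
  then have "(LINT x:I01|lebesgue. x * deriv \<phi> x + \<phi> x) = 1 * \<phi> 1 - 0 * \<phi> 0"
    by (rule set_integral_FTC) (intro continuous_intros c)
  moreover have "(LINT x:I01|lebesgue. x * deriv \<phi> x + \<phi> x) =
      (LINT x:I01|lebesgue. x * deriv \<phi> x) + (LINT x:I01|lebesgue. \<phi> x)"
    by (intro set_integral_add continuous_set_integrable_I01 continuous_intros c)
  ultimately show ?thesis by (simp add: test_function_eq_0[OF assms])
qed

text \<open>Let \<open>b\<close> have integral 1. A test function \<open>\<psi>\<close> with
  integral \<open>m\<close> is \<open>m * b\<close> plus the derivative of a test function. Hence
  \<open>h\<close> tested with \<open>\<psi>\<close> gives \<open>m * \<alpha>\<close>, just as the
  constant \<open>\<alpha>\<close> does, and the fundamental lemma applies to the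
  difference.\<close>

lemma du_Bois_Reymond:
  assumes h: "h \<in> L1_loc"
    and 0: "\<And>\<phi>. \<phi> \<in> test_functions \<Longrightarrow> (LINT x:I01|lebesgue. h x * deriv \<phi> x) = 0"
  obtains \<alpha> where "AE x in lebesgue. x \<in> I01 \<longrightarrow> h x = \<alpha>"
proof -
  obtain b where b: "b \<in> test_functions" "(LINT x:I01|lebesgue. b x) = 1"
    using normalized_test_function by blast
  define \<alpha> where "\<alpha> = (LINT x:I01|lebesgue. h x * b x)"
  have c: "(\<lambda>_. \<alpha>) \<in> L1_loc"
    by (intro set_integrable_I01_L1_loc continuous_set_integrable_I01) simp
  have "AE x in lebesgue. x \<in> I01 \<longrightarrow> h x - \<alpha> = 0"
  proof (rule L1_loc_AE_zero)
    show "(\<lambda>x. h x - \<alpha>) \<in> L1_loc"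
      using h c by (auto simp: L1_loc_def)
  next
    fix \<psi> assume \<psi>: "\<psi> \<in> test_functions"
    define m where "m = (LINT x:I01|lebesgue. \<psi> x)"
    have i: "set_integrable lebesgue I01 \<psi>" "set_integrable lebesgue I01 b"
      using \<psi> b(1) by (auto intro!: continuous_set_integrable_I01 smooth_continuous_on test_function_smooth)
    have "(LINT x:I01|lebesgue. \<psi> x + (- m) * b x) = 0"
      using i b(2) by (simp add: m_def)
    with \<psi> b(1) obtain \<phi> where \<phi>: "\<phi> \<in> test_functions" "deriv \<phi> = (\<lambda>x. \<psi> x + (- m) * b x)"
      using test_function_primitive test_function_add_cmult by metis
    have hi: "set_integrable lebesgue I01 (\<lambda>x. h x * \<psi> x)" "set_integrable lebesgue I01 (\<lambda>x. h x * b x)"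
      using L1_loc_mult_test_function h \<psi> b(1) by auto
    have "0 = (LINT x:I01|lebesgue. h x * \<psi> x - m * (h x * b x))"
      using 0[OF \<phi>(1)] by (simp add: \<phi>(2) algebra_simps)
    also have "\<dots> = (LINT x:I01|lebesgue. h x * \<psi> x) - m * \<alpha>"
      using hi by (simp add: \<alpha>_def)
    also have "\<dots> = (LINT x:I01|lebesgue. h x * \<psi> x) - (LINT x:I01|lebesgue. \<alpha> * \<psi> x)"
      by (simp add: m_def)
    also have "\<dots> = (LINT x:I01|lebesgue. (h x - \<alpha>) * \<psi> x)"
      using hi i by (simp add: left_diff_distrib)
    finally show "(LINT x:I01|lebesgue. (h x - \<alpha>) * \<psi> x) = 0" by simp
  qed
  then show ?thesis using that by simp
qed

text \<open>Subtracting a suitable linear function from \<open>h\<close> makes the integrals against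
  first derivatives vanish too, which reduces the claim to \<open>du_Bois_Reymond\<close>.\<close>

lemma du_Bois_Reymond2:
  assumes h: "h \<in> L1_loc"
    and 0: "\<And>\<phi>. \<phi> \<in> test_functions \<Longrightarrow> (LINT x:I01|lebesgue. h x * deriv (deriv \<phi>) x) = 0"
  obtains \<alpha> \<beta> where "AE x in lebesgue. x \<in> I01 \<longrightarrow> h x = \<alpha> + \<beta> * x"
proof -
  obtain b where b: "b \<in> test_functions" "(LINT x:I01|lebesgue. b x) = 1"
    using normalized_test_function by blast
  \<comment> \<open>The slope is forced: integrating an affine function against
    \<open>deriv b\<close> gives minus its slope, because \<open>b\<close> has integral 1.\<close>
  define \<beta> where "\<beta> = - (LINT x:I01|lebesgue. h x * deriv b x)"
  have c: "(\<lambda>x. \<beta> * x) \<in> L1_loc"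
    by (intro set_integrable_I01_L1_loc continuous_set_integrable_I01 continuous_intros)
  have "\<exists>\<alpha>. AE x in lebesgue. x \<in> I01 \<longrightarrow> h x - \<beta> * x = \<alpha>"
  proof (rule du_Bois_Reymond)
    show "(\<lambda>x. h x - \<beta> * x) \<in> L1_loc"
      using h c by (auto simp: L1_loc_def)
  next
    fix \<psi> assume \<psi>: "\<psi> \<in> test_functions"
    define m where "m = (LINT x:I01|lebesgue. \<psi> x)"
    have i: "set_integrable lebesgue I01 \<psi>" "set_integrable lebesgue I01 b"
      using \<psi> b(1) by (auto intro!: continuous_set_integrable_I01 smooth_continuous_on test_function_smooth)
    have "(LINT x:I01|lebesgue. \<psi> x + (- m) * b x) = 0"
      using i b(2) by (simp add: m_def)
    with \<psi> b(1) obtain \<phi> where \<phi>: "\<phi> \<in> test_functions" "deriv \<phi> = (\<lambda>x. \<psi> x + (- m) * b x)"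
      using test_function_primitive test_function_add_cmult by metis
    \<comment> \<open>Up to a multiple of \<open>deriv b\<close>, the function
      \<open>deriv \<psi>\<close> is thus the second derivative of a test function, and the
      hypothesis can be used.\<close>
    have "deriv (deriv \<phi>) = (\<lambda>x. deriv \<psi> x + (- m) * deriv b x)"
      unfolding \<phi>(2)
      by (rule deriv_eqI)
        (auto intro!: derivative_eq_intros smooth_DERIV test_function_smooth \<psi> b(1))
    then have e: "h x * deriv (deriv \<phi>) x = h x * deriv \<psi> x - m * (h x * deriv b x)" for x
      by (simp add: algebra_simps)
    have hi: "set_integrable lebesgue I01 (\<lambda>x. h x * deriv \<psi> x)"
      "set_integrable lebesgue I01 (\<lambda>x. h x * deriv b x)"
      using L1_loc_mult_test_function[OF h test_function_deriv] \<psi> b(1) by auto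
    have i': "set_integrable lebesgue I01 (\<lambda>x. x * deriv \<psi> x)"
      using \<psi> by (intro continuous_set_integrable_I01 continuous_intros smooth_continuous_on test_function_smooth test_function_deriv)
    have "0 = (LINT x:I01|lebesgue. h x * deriv \<psi> x - m * (h x * deriv b x))"
      using 0[OF \<phi>(1)] by (simp add: e)
    also have "\<dots> = (LINT x:I01|lebesgue. h x * deriv \<psi> x) + \<beta> * m"
      using hi by (simp add: \<beta>_def)
    also have "\<dots> = (LINT x:I01|lebesgue. h x * deriv \<psi> x) - (LINT x:I01|lebesgue. \<beta> * (x * deriv \<psi> x))"
      using set_integral_id_mult_deriv[OF \<psi>] by (simp add: m_def)
    also have "\<dots> = (LINT x:I01|lebesgue. (h x - \<beta> * x) * deriv \<psi> x)"
      using hi i' by (simp add: left_diff_distrib mult.assoc)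
    finally show "(LINT x:I01|lebesgue. (h x - \<beta> * x) * deriv \<psi> x) = 0" by simp
  qed blast
  then obtain \<alpha> where "AE x in lebesgue. x \<in> I01 \<longrightarrow> h x - \<beta> * x = \<alpha>" by blast
  then have "AE x in lebesgue. x \<in> I01 \<longrightarrow> h x = \<alpha> + \<beta> * x"
    by eventually_elim (simp add: algebra_simps)
  then show ?thesis using that by blast
qed

section \<open>Potentials\<close>

text \<open>The Green function of the Dirichlet problem for \<open>- v'' = f\<close> on (0,1).\<close>

definition green :: "real \<Rightarrow> real \<Rightarrow> real" where
  "green x y = min x y - x * y"

lemma green_nonneg: "x \<in> {0..1} \<Longrightarrow> y \<in> {0..1} \<Longrightarrow> 0 \<le> green x y"
  by (cases "x \<le> y") (auto simp: green_def min_def mult_left_le mult_right_le_one_le mult_left_le_one_le)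

text \<open>The bound is uniform in \<open>x\<close>, so y (1 - y) |f(y)| dominates the integrand of
  the potential of f.\<close>

lemma green_le: "x \<in> {0..1} \<Longrightarrow> y \<in> {0..1} \<Longrightarrow> green x y \<le> y * (1 - y)"
proof -
  assume a: "x \<in> {0..1}" "y \<in> {0..1}"
  show ?thesis
  proof (cases "x \<le> y")
    case True
    then have "x * (1 - y) \<le> y * (1 - y)" using a by (intro mult_right_mono) auto
    then show ?thesis using True by (simp add: green_def algebra_simps)
  next
    case False
    then have "y * (1 - x) \<le> y * (1 - y)" using a by (intro mult_left_mono) auto
    then show ?thesis using False by (simp add: green_def algebra_simps)
  qed
qed

text \<open>As a function of \<open>x\<close>, \<open>green x y\<close> is linear on both sides of
  \<open>y\<close>, and its slope drops by 1 there: its second derivative is minus the point mass at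
  \<open>y\<close>.\<close>

lemma set_integral_green_mult_deriv2:
  assumes \<phi>: "\<phi> \<in> test_functions" and y: "y \<in> I01"
  shows "(LINT x:I01|lebesgue. green x y * deriv (deriv \<phi>) x) = - \<phi> y"
proof -
  have s: "smooth \<phi>" by (rule test_function_smooth[OF \<phi>])
  note D = smooth_DERIV[OF s] smooth_DERIV[OF smooth_deriv[OF s]]
  let ?f = "\<lambda>x. green x y * deriv (deriv \<phi>) x"
  have vec: "(F has_vector_derivative f x) (at x within A)"
    if "(F has_real_derivative f x) (at x)" for F f :: "real \<Rightarrow> real" and x A
    using that by (simp add: has_real_derivative_iff_has_vector_derivative[symmetric] has_field_derivative_at_within)
  \<comment> \<open>The values are those of explicit antiderivatives at the ends of the two pieces.
    At \<open>y\<close> the terms with \<open>deriv \<phi> y\<close> cancel and those with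
    \<open>\<phi> y\<close> add up to \<open>- \<phi> y\<close>.\<close>
  have 1: "(?f has_integral (1 - y) * (y * deriv \<phi> y - \<phi> y) - (1 - y) * (0 * deriv \<phi> 0 - \<phi> 0)) {0..y}"
  proof (rule has_integral_eq)
    show "((\<lambda>x. (1 - y) * (x * deriv (deriv \<phi>) x)) has_integral
        (1 - y) * (y * deriv \<phi> y - \<phi> y) - (1 - y) * (0 * deriv \<phi> 0 - \<phi> 0)) {0..y}"
      using y by (intro fundamental_theorem_of_calculus vec) (auto intro!: derivative_eq_intros D)
  qed (auto simp: green_def min_def algebra_simps)
  have 2: "(?f has_integral y * ((1 - 1) * deriv \<phi> 1 + \<phi> 1) - y * ((1 - y) * deriv \<phi> y + \<phi> y)) {y..1}"
  proof (rule has_integral_eq)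
    show "((\<lambda>x. y * ((1 - x) * deriv (deriv \<phi>) x)) has_integral
        y * ((1 - 1) * deriv \<phi> 1 + \<phi> 1) - y * ((1 - y) * deriv \<phi> y + \<phi> y)) {y..1}"
      using y by (intro fundamental_theorem_of_calculus vec) (auto intro!: derivative_eq_intros D)
  qed (auto simp: green_def min_def algebra_simps)
  have "(?f has_integral - \<phi> y) {0..1}"
    using has_integral_combine[OF _ _ 1 2] y
    by (simp add: test_function_eq_0[OF \<phi>] algebra_simps)
  then have "(?f has_integral - \<phi> y) I01" by (simp add: has_integral_Icc_iff_Ioo)
  moreover have "continuous_on {0..1} ?f"
    unfolding green_def
    by (intro continuous_intros smooth_continuous_on smooth_deriv s)
  ultimately show ?thesis
    using set_lebesgue_integral_eq_integral(2)[OF continuous_set_integrable_I01]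
    by (simp add: integral_unique)
qed

text \<open>\<open>v\<close> is minus the Green potential, so that v'' = f as distributions. The
  weight y (1 - y) dominates the kernel, which gives continuity by dominated convergence and the
  equation by Fubini.\<close>

lemma green_potential:
  assumes meas: "set_borel_measurable lebesgue I01 f"
    and int: "set_integrable lebesgue I01 (\<lambda>y. y * (1 - y) * f y)"
  obtains v where "continuous_on {0..1} v"
    "\<And>\<phi>. \<phi> \<in> test_functions \<Longrightarrow>
       (LINT x:I01|lebesgue. v x * deriv (deriv \<phi>) x) = (LINT x:I01|lebesgue. f x * \<phi> x)"
proof -
  \<comment> \<open>Fubini is applied on the product of two copies of \<open>lborel\<close>, so
    \<open>f\<close> is replaced by a Borel representative.\<close>
  obtain g0 where g0[measurable]: "g0 \<in> borel_measurable borel"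
    and ae0: "AE x in lborel. indicator I01 x * f x = g0 x"
    using completion_ex_borel_measurable_real[of "\<lambda>x. indicator I01 x * f x" lborel] meas
    by (auto simp: set_borel_measurable_def)
  \<comment> \<open>\<open>g0\<close> vanishes outside (0,1) only almost everywhere; cutting it off
    again makes the bounds below hold at every point.\<close>
  define g where "g = (\<lambda>x. indicator I01 x * g0 x)"
  have [measurable]: "g \<in> borel_measurable borel" by (simp add: g_def)
  have g_out: "g x = 0" if "x \<notin> I01" for x using that by (simp add: g_def)
  have "AE x in lborel. indicator I01 x * f x = g x"
    using ae0
  proof eventually_elim
    fix x assume "indicator I01 x * f x = g0 x"
    then show "indicator I01 x * f x = g x"
      by (cases "x \<in> I01") (simp_all add: g_def)
  qed
  then have ae: "AE x in lebesgue. indicator I01 x * f x = g x"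
    by (rule AE_completion)
  have mf: "(\<lambda>x. indicator I01 x * f x) \<in> borel_measurable lebesgue"
    using meas by (simp add: set_borel_measurable_def)
  have "integrable lebesgue (\<lambda>y. y * (1 - y) * g y)"
  proof (rule integrable_cong_AE_imp)
    show "integrable lebesgue (\<lambda>y. indicator I01 y * (y * (1 - y) * f y))"
      using int by (simp add: set_integrable_def)
    show "(\<lambda>y. y * (1 - y) * g y) \<in> borel_measurable lebesgue"
      by (simp add: measurable_completion)
    show "AE y in lebesgue. indicator I01 y * (y * (1 - y) * f y) = y * (1 - y) * g y"
      using ae by eventually_elim (simp add: mult.left_commute mult.assoc)
  qed
  then have wint: "integrable lborel (\<lambda>y. y * (1 - y) * g y)"
    by (subst (asm) integrable_completion) auto
  have [measurable]: "green x \<in> borel_measurable borel" for x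
    unfolding green_def by (intro borel_measurable_continuous_onI continuous_intros)
  have bound: "\<bar>green x y * g y\<bar> \<le> \<bar>y * (1 - y) * g y\<bar>" if "x \<in> {0..1}" for x y
  proof (cases "y \<in> I01")
    case True
    then have "\<bar>green x y\<bar> \<le> \<bar>y * (1 - y)\<bar>"
      using green_nonneg[OF that, of y] green_le[OF that, of y] by auto
    then show ?thesis by (simp only: abs_mult mult_right_mono abs_ge_zero)
  qed (simp add: g_out)
  define v where "v = (\<lambda>x. - (LINT y|lborel. green x y * g y))"
  show ?thesis
  proof
    show "continuous_on {0..1} v"
      unfolding continuous_on_sequentially
    proof (intro allI ballI impI)
      fix X and x :: real assume x: "x \<in> {0..1}" and X: "(\<forall>n. X n \<in> {0..1}) \<and> X \<longlonglongrightarrow> x"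
      have "(\<lambda>n. LINT y|lborel. green (X n) y * g y) \<longlonglongrightarrow> (LINT y|lborel. green x y * g y)"
      proof (rule integral_dominated_convergence)
        show "integrable lborel (\<lambda>y. \<bar>y * (1 - y) * g y\<bar>)" using wint by simp
        show "AE y in lborel. norm (green (X n) y * g y) \<le> \<bar>y * (1 - y) * g y\<bar>" for n
          using bound X by auto
        show "AE y in lborel. (\<lambda>n. green (X n) y * g y) \<longlonglongrightarrow> green x y * g y"
          unfolding green_def using X by (intro AE_I2 tendsto_intros) auto
      qed auto
      then show "(v \<circ> X) \<longlonglongrightarrow> v x"
        unfolding v_def comp_def by (rule tendsto_minus)
    qed
  next
    fix \<phi> assume \<phi>: "\<phi> \<in> test_functions"
    define \<eta> where "\<eta> = deriv (deriv \<phi>)"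
    have \<eta>: "\<eta> \<in> test_functions" unfolding \<eta>_def by (intro test_function_deriv \<phi>)
    have cut: "indicator I01 x *\<^sub>R (c * \<eta> x) = c * \<eta> x" for c x
      using test_function_eq_0[OF \<eta>, of x] by (cases "x \<in> I01") auto
    note [measurable] = test_function_measurable[OF \<eta>] test_function_measurable[OF \<phi>]
    have \<eta>i: "integrable lborel \<eta>"
    proof -
      have "integrable lborel (\<lambda>x. indicator {0..1} x *\<^sub>R \<eta> x)"
        using \<eta> by (intro borel_integrable_compact smooth_continuous_on test_function_smooth) auto
      also have "(\<lambda>x. indicator {0..1} x *\<^sub>R \<eta> x) = \<eta>"
      proof
        show "indicator {0..1} x *\<^sub>R \<eta> x = \<eta> x" for x
          using test_function_eq_0[OF \<eta>, of x] by (cases "x \<in> {0..1}") auto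
      qed
      finally show ?thesis .
    qed
    \<comment> \<open>The kernel bound holds for \<open>x\<close> in [0,1]; elsewhere
      \<open>\<eta>\<close> vanishes. The right side is an integrable function of \<open>x\<close>
      times one of \<open>y\<close>, which yields integrability on the plane.\<close>
    have b2: "norm (\<eta> x * (green x y * g y)) \<le> norm (\<eta> x * (y * (1 - y) * g y))" for x y
    proof (cases "x \<in> {0..1}")
      case True
      then show ?thesis
        using bound[OF True, of y] by (simp only: real_norm_def abs_mult[of "\<eta> x"] mult_left_mono abs_ge_zero)
    next
      case False
      then show ?thesis using test_function_eq_0[OF \<eta>, of x] by auto
    qed
    have i1: "integrable lborel (\<lambda>y. \<eta> x * (green x y * g y))" for x
      by (rule Bochner_Integration.integrable_bound[of _ "\<lambda>y. \<eta> x * (y * (1 - y) * g y)"])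
        (use wint b2 in auto)
    have "integrable (lborel \<Otimes>\<^sub>M lborel) (\<lambda>(x, y). \<eta> x * (green x y * g y))"
    proof (rule lborel_pair.Fubini_integrable)
      show "(\<lambda>(x, y). \<eta> x * (green x y * g y)) \<in> borel_measurable (lborel \<Otimes>\<^sub>M lborel)"
        unfolding green_def by measurable
      show "AE x in lborel. integrable lborel (\<lambda>y. case (x, y) of (x, y) \<Rightarrow> \<eta> x * (green x y * g y))"
        using i1 by simp
      have "integrable lborel (\<lambda>x. LINT y|lborel. norm (\<eta> x * (green x y * g y)))"
      proof (rule Bochner_Integration.integrable_bound)
        show "integrable lborel (\<lambda>x. \<eta> x * (LINT y|lborel. \<bar>y * (1 - y) * g y\<bar>))"
          using \<eta>i by simp
        show "(\<lambda>x. LINT y|lborel. norm (\<eta> x * (green x y * g y))) \<in> borel_measurable lborel"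
          unfolding green_def by measurable
        show "AE x in lborel. norm (LINT y|lborel. norm (\<eta> x * (green x y * g y)))
            \<le> norm (\<eta> x * (LINT y|lborel. \<bar>y * (1 - y) * g y\<bar>))"
        proof (intro AE_I2)
          fix x
          have "(LINT y|lborel. norm (\<eta> x * (green x y * g y))) \<le> (LINT y|lborel. norm (\<eta> x * (y * (1 - y) * g y)))"
            using i1 wint b2 by (intro integral_mono) auto
          also have "\<dots> = \<bar>\<eta> x\<bar> * (LINT y|lborel. \<bar>y * (1 - y) * g y\<bar>)"
            by (simp add: abs_mult)
          finally show "norm (LINT y|lborel. norm (\<eta> x * (green x y * g y)))
            \<le> norm (\<eta> x * (LINT y|lborel. \<bar>y * (1 - y) * g y\<bar>))"
            by (simp add: abs_mult)
        qed
      qed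
      then show "integrable lborel (\<lambda>x. LINT y|lborel. norm (case (x, y) of (x, y) \<Rightarrow> \<eta> x * (green x y * g y)))"
        by simp
    qed
    note fub = lborel_pair.Fubini_integral[OF this]
    \<comment> \<open>With the order of integration exchanged, the integral over \<open>x\<close> is
      the Green identity at a fixed \<open>y\<close>.\<close>
    have inner: "(LINT x|lborel. \<eta> x * (green x y * g y)) = - (g y * \<phi> y)" for y
    proof (cases "y \<in> I01")
      case True
      have [measurable]: "(\<lambda>x. green x y) \<in> borel_measurable borel"
        unfolding green_def by (intro borel_measurable_continuous_onI continuous_intros)
      have "(LINT x|lborel. \<eta> x * (green x y * g y)) = g y * (LINT x|lborel. green x y * \<eta> x)"
        by (simp add: ac_simps flip: integral_mult_right_zero)
      also have "(LINT x|lborel. green x y * \<eta> x) = (LINT x|lebesgue. green x y * \<eta> x)"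
        by (subst integral_completion) auto
      also have "\<dots> = (LINT x:I01|lebesgue. green x y * \<eta> x)"
        by (simp only: set_lebesgue_integral_def cut)
      also have "\<dots> = - \<phi> y"
        unfolding \<eta>_def by (rule set_integral_green_mult_deriv2[OF \<phi> True])
      finally show ?thesis by simp
    qed (simp add: g_out)
    have "(LINT x:I01|lebesgue. v x * \<eta> x) = (LINT x|lebesgue. \<eta> x * v x)"
      by (simp only: set_lebesgue_integral_def cut mult.commute[of "\<eta> _"])
    also have "\<dots> = (LINT x|lborel. \<eta> x * v x)"
    proof (rule integral_completion)
      have [measurable]: "v \<in> borel_measurable borel"
        unfolding v_def green_def by measurable
      show "(\<lambda>x. \<eta> x * v x) \<in> borel_measurable lborel" by measurable
    qed
    also have "\<dots> = - (LINT x|lborel. LINT y|lborel. \<eta> x * (green x y * g y))"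
      by (simp add: v_def)
    also have "\<dots> = (LINT y|lborel. g y * \<phi> y)"
      unfolding fub[symmetric] inner by simp
    also have "\<dots> = (LINT y|lebesgue. g y * \<phi> y)"
      by (subst integral_completion) auto
    also have "\<dots> = (LINT y|lebesgue. indicator I01 y *\<^sub>R (f y * \<phi> y))"
    proof (rule integral_cong_AE)
      have "\<phi> \<in> borel_measurable lebesgue" by (simp add: measurable_completion)
      then show "(\<lambda>y. indicator I01 y *\<^sub>R (f y * \<phi> y)) \<in> borel_measurable lebesgue"
        using borel_measurable_times[OF mf, of \<phi>] by (simp add: mult.assoc)
      show "AE y in lebesgue. g y * \<phi> y = indicator I01 y *\<^sub>R (f y * \<phi> y)"
        using ae by eventually_elim (simp add: mult.assoc[symmetric])
    qed (simp add: measurable_completion)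
    finally show "(LINT x:I01|lebesgue. v x * deriv (deriv \<phi>) x) = (LINT x:I01|lebesgue. f x * \<phi> x)"
      by (simp add: \<eta>_def set_lebesgue_integral_def)
  qed
qed

section \<open>Weighted spaces\<close>

lemma L1_loc_measurable:
  assumes "f \<in> L1_loc"
  shows "set_borel_measurable lebesgue I01 f"
  unfolding set_borel_measurable_def
proof (rule borel_measurable_LIMSEQ_real)
  \<comment> \<open>These compact intervals exhaust (0,1). Local integrability gives measurability
    on each, and measurability passes to the pointwise limit.\<close>
  let ?K = "\<lambda>n. {1 / real (n + 2)..1 - 1 / real (n + 2)}"
  show "(\<lambda>x. indicator (?K n) x *\<^sub>R f x) \<in> borel_measurable lebesgue" for n
  proof -
    have "0 < 1 / real (n + 2)" by simp
    then have "x \<in> I01" if "x \<in> ?K n" for x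
      using that unfolding atLeastAtMost_iff greaterThanLessThan_iff by linarith
    then have "compact (?K n) \<and> ?K n \<subseteq> I01" by blast
    then have "set_integrable lebesgue (?K n) f"
      using assms unfolding L1_loc_def by blast
    then show ?thesis by (simp add: set_integrable_def borel_measurable_integrable)
  qed
  fix x :: real
  show "(\<lambda>n. indicator (?K n) x *\<^sub>R f x) \<longlonglongrightarrow> indicator I01 x *\<^sub>R f x"
  proof (cases "x \<in> I01")
    case True
    then have "0 < x" "0 < 1 - x" by auto
    have lim: "(\<lambda>n. 1 / real (n + 2)) \<longlonglongrightarrow> 0"
      by (rule LIMSEQ_ignore_initial_segment[OF lim_1_over_n])
    have "eventually (\<lambda>n. 1 / real (n + 2) < x) sequentially"
      "eventually (\<lambda>n. 1 / real (n + 2) < 1 - x) sequentially"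
      using order_tendstoD(2)[OF lim \<open>0 < x\<close>] order_tendstoD(2)[OF lim \<open>0 < 1 - x\<close>] .
    then have "eventually (\<lambda>n. indicator (?K n) x *\<^sub>R f x = indicator I01 x *\<^sub>R f x) sequentially"
      by eventually_elim (use True in auto)
    then show ?thesis by (rule tendsto_eventually)
  next
    case False
    have "0 < 1 / real (n + 2)" for n by simp
    with False have "x \<notin> ?K n" for n
      by (smt (verit) atLeastAtMost_iff greaterThanLessThan_iff)
    with False show ?thesis by simp
  qed
qed

text \<open>\<open>u2\<close> and the potential \<open>v\<close> built from \<open>u4\<close> have
  the same second distributional derivative \<open>u4\<close>. They differ by an affine function, so
  \<open>u2\<close> inherits the continuity of \<open>v\<close>.\<close>

lemma weak_deriv_2_continuous:
  assumes u4: "weak_deriv 4 u u4" and u2: "weak_deriv 2 u u2"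
    and int: "set_integrable lebesgue I01 (\<lambda>y. y * (1 - y) * u4 y)"
  obtains w where "continuous_on {0..1} w" "ae_eq u2 w"
proof -
  have "u4 \<in> L1_loc" and u2l: "u2 \<in> L1_loc" using u4 u2 by (auto simp: weak_deriv_def)
  then obtain v where v: "continuous_on {0..1} v"
    "\<And>\<phi>. \<phi> \<in> test_functions \<Longrightarrow>
       (LINT x:I01|lebesgue. v x * deriv (deriv \<phi>) x) = (LINT x:I01|lebesgue. u4 x * \<phi> x)"
    using green_potential[OF L1_loc_measurable int] by blast
  have vl: "v \<in> L1_loc"
    by (intro set_integrable_I01_L1_loc continuous_set_integrable_I01 v)
  obtain \<alpha> \<beta> where ab: "AE x in lebesgue. x \<in> I01 \<longrightarrow> u2 x - v x = \<alpha> + \<beta> * x"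
  proof (rule du_Bois_Reymond2)
    show "(\<lambda>x. u2 x - v x) \<in> L1_loc" using u2l vl by (auto simp: L1_loc_def)
  next
    fix \<phi> assume \<phi>: "\<phi> \<in> test_functions"
    define \<psi> where "\<psi> = deriv (deriv \<phi>)"
    have \<psi>: "\<psi> \<in> test_functions" unfolding \<psi>_def by (intro test_function_deriv \<phi>)
    \<comment> \<open>Testing \<open>u2\<close> with the second derivative of \<open>\<phi>\<close>
      brings in the fourth one; the signs for orders 2 and 4 are both 1.\<close>
    have "(LINT x:I01|lebesgue. u2 x * \<psi> x) = (LINT x:I01|lebesgue. u x * (deriv ^^ 2) \<psi> x)"
      using u2 \<psi> by (simp add: weak_deriv_def)
    also have "(deriv ^^ 2) \<psi> = (deriv ^^ 4) \<phi>"
      by (simp add: \<psi>_def eval_nat_numeral)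
    also have "(LINT x:I01|lebesgue. u x * (deriv ^^ 4) \<phi> x) = (LINT x:I01|lebesgue. u4 x * \<phi> x)"
      using u4 \<phi> by (simp add: weak_deriv_def)
    also have "\<dots> = (LINT x:I01|lebesgue. v x * \<psi> x)"
      using v(2)[OF \<phi>] by (simp add: \<psi>_def)
    finally show "(LINT x:I01|lebesgue. (u2 x - v x) * deriv (deriv \<phi>) x) = 0"
      using L1_loc_mult_test_function[OF u2l \<psi>] L1_loc_mult_test_function[OF vl \<psi>]
      by (simp add: left_diff_distrib flip: \<psi>_def)
  qed blast
  show ?thesis
  proof
    show "continuous_on {0..1} (\<lambda>x. v x + \<alpha> + \<beta> * x)" by (intro continuous_intros v)
    show "ae_eq u2 (\<lambda>x. v x + \<alpha> + \<beta> * x)"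
      unfolding ae_eq_def using ab by eventually_elim (simp add: algebra_simps)
  qed
qed

section \<open>Consequences of the bound on the weight\<close>

lemma square_dist_le_weight:
  fixes a :: "real \<Rightarrow> real"
  assumes "x0 \<in> {0..1}" "a x0 = 0" "\<forall>x\<in>{0..1} - {x0}. 0 < a x" "K \<in> {1..2}" "C > 0"
    "\<forall>x\<in>{0..1} - {x0}. 1 / a x \<le> C / \<bar>x - x0\<bar> powr K" "x \<in> {0..1}"
  shows "(x - x0)\<^sup>2 \<le> C * a x"
proof (cases "x = x0")
  case False
  then have pos: "0 < \<bar>x - x0\<bar>" and a: "0 < a x" using assms by auto
  have "\<bar>x - x0\<bar> \<le> 1" using assms(1,7) by auto
  \<comment> \<open>For a base in (0,1] powers decrease with the exponent; here
    \<open>K \<le> 2\<close> enters.\<close>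
  then have "\<bar>x - x0\<bar> powr 2 \<le> \<bar>x - x0\<bar> powr K"
    using pos assms(4) by (intro powr_mono') auto
  then have "(x - x0)\<^sup>2 \<le> \<bar>x - x0\<bar> powr K" using pos by simp
  also have "\<bar>x - x0\<bar> powr K \<le> C * a x"
  proof -
    have "1 / a x \<le> C / \<bar>x - x0\<bar> powr K" using assms(6,7) False by blast
    then show ?thesis using a pos by (simp add: field_simps)
  qed
  finally show ?thesis .
qed (use assms in simp)

text \<open>Since (x - x0)^2 f^2 \<le> C a f^2 = C (a f)^2 / a, the function (x - x0) f is square
  integrable, hence integrable. It remains to compare y (1 - y) with |y - x0|, using local
  integrability of \<open>f\<close> if \<open>x0\<close> is interior.\<close>

lemma weighted_L2_integrable:
  fixes a f :: "real \<Rightarrow> real"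
  assumes x0: "x0 \<in> {0..1}" and a: "\<And>x. x \<in> {0..1} \<Longrightarrow> (x - x0)\<^sup>2 \<le> C * a x"
    and f: "f \<in> L1_loc" and af: "(\<lambda>x. a x * f x) \<in> L2w a"
  shows "set_integrable lebesgue I01 (\<lambda>y. y * (1 - y) * f y)"
proof -
  note m = L1_loc_measurable[OF f]
  have mult: "set_borel_measurable lebesgue I01 (\<lambda>x. p x * f x)"
    if "p \<in> borel_measurable borel" for p :: "real \<Rightarrow> real"
  proof -
    have "p \<in> borel_measurable lebesgue" using that by (simp add: measurable_completion)
    then have "(\<lambda>x. p x * (indicator I01 x *\<^sub>R f x)) \<in> borel_measurable lebesgue"
      using m unfolding set_borel_measurable_def by (rule borel_measurable_times)
    then show ?thesis by (simp add: set_borel_measurable_def mult.left_commute)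
  qed
  have 1: "set_integrable lebesgue I01 (\<lambda>x. (x - x0) * f x)"
  proof (rule set_integrable_bound)
    have "set_integrable lebesgue I01 (\<lambda>x. (a x * f x)\<^sup>2 / a x)"
      using af by (simp add: L2w_def)
    then show "set_integrable lebesgue I01 (\<lambda>x. 1 + C * ((a x * f x)\<^sup>2 / a x))"
      by (intro set_integral_add(1) set_integrable_mult_right)
        (auto intro: continuous_set_integrable_I01)
    show "set_borel_measurable lebesgue I01 (\<lambda>x. (x - x0) * f x)"
      by (rule mult) simp
    have "\<bar>(x - x0) * f x\<bar> \<le> \<bar>1 + C * ((a x * f x)\<^sup>2 / a x)\<bar>" if "x \<in> I01" for x
    proof -
      have "\<bar>t\<bar> \<le> 1 + t\<^sup>2" for t :: real
        using zero_le_power2[of "\<bar>t\<bar> - 1"] by (simp add: power2_diff)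
      then have "\<bar>(x - x0) * f x\<bar> \<le> 1 + ((x - x0) * f x)\<^sup>2" .
      also have "\<dots> = 1 + (x - x0)\<^sup>2 * (f x)\<^sup>2" by (simp add: power_mult_distrib)
      also have "\<dots> \<le> 1 + (C * a x) * (f x)\<^sup>2"
        using a[of x] that by (intro add_left_mono mult_right_mono) auto
      \<comment> \<open>This holds at a zero of \<open>a\<close> as well: division by 0 gives 0, and
        both sides vanish.\<close>
      also have "(C * a x) * (f x)\<^sup>2 = C * ((a x * f x)\<^sup>2 / a x)"
        by (simp add: power_mult_distrib power2_eq_square)
      finally show ?thesis by linarith
    qed
    then show "AE x in lebesgue. x \<in> I01 \<longrightarrow> norm ((x - x0) * f x) \<le> norm (1 + C * ((a x * f x)\<^sup>2 / a x))"
      by simp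
  qed
  have my: "set_borel_measurable lebesgue I01 (\<lambda>y. y * (1 - y) * f y)"
    by (rule mult) simp
  show ?thesis
  proof (cases "x0 \<in> I01")
    case False
    then have "x0 = 0 \<or> x0 = 1" using x0 by auto
    \<comment> \<open>y (1 - y) is the product of the distances to the two end points, each at most
      1, and \<open>x0\<close> is one of these points.\<close>
    then have "\<bar>y * (1 - y)\<bar> \<le> \<bar>y - x0\<bar>" if "y \<in> I01" for y
      using that by (auto simp: abs_mult intro: mult_left_le mult_left_le_one_le)
    then have "\<bar>y * (1 - y) * f y\<bar> \<le> \<bar>(y - x0) * f y\<bar>" if "y \<in> I01" for y
      using that unfolding abs_mult[of _ "f y"] by (simp add: mult_right_mono)
    then show ?thesis
      by (intro set_integrable_bound[OF 1 my]) simp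
  next
    case True
    \<comment> \<open>\<open>K\<close> reaches from \<open>x0\<close> halfway to both end points,
      and \<open>m\<close> is the distance from \<open>x0\<close> to the nearer end of
      \<open>K\<close>. On \<open>K\<close> the function \<open>f\<close> itself is integrable; off
      \<open>K\<close> the factor |y - x0| is at least \<open>m\<close>.\<close>
    define K where "K = {x0 / 2..(1 + x0) / 2}"
    define m where "m = min (x0 / 2) ((1 - x0) / 2)"
    have m: "m > 0" using True by (simp add: m_def)
    have KI: "K \<subseteq> I01" using True by (auto simp: K_def)
    have "set_integrable lebesgue K f"
      using f KI by (auto simp: L1_loc_def K_def)
    then have "integrable lebesgue (\<lambda>x. indicator K x *\<^sub>R f x)"
      by (simp add: set_integrable_def)
    also have "(\<lambda>x. indicator K x *\<^sub>R f x) = (\<lambda>x. indicator I01 x *\<^sub>R (indicator K x * f x))"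
      using KI by (auto simp: indicator_def fun_eq_iff)
    finally have 2: "set_integrable lebesgue I01 (\<lambda>x. indicator K x * f x)"
      by (simp add: set_integrable_def)
    show ?thesis
    proof (rule set_integrable_bound[OF _ my])
      show "set_integrable lebesgue I01 (\<lambda>y. \<bar>indicator K y * f y\<bar> + 1 / m * \<bar>(y - x0) * f y\<bar>)"
        by (intro set_integral_add(1) set_integrable_mult_right set_integrable_abs 1 2)
      have "\<bar>y * (1 - y) * f y\<bar> \<le> \<bar>indicator K y * f y\<bar> + 1 / m * \<bar>(y - x0) * f y\<bar>" if y: "y \<in> I01" for y
      proof -
        have "y * (1 - y) \<le> 1" using y by (intro mult_le_one) auto
        then have y1: "\<bar>y * (1 - y)\<bar> \<le> 1" using y by (simp add: abs_mult)
        have "\<bar>y * (1 - y)\<bar> \<le> indicator K y + 1 / m * \<bar>y - x0\<bar>"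
        proof (cases "y \<in> K")
          case True
          then show ?thesis using y1 m by (simp add: add_increasing2)
        next
          case False
          then have "m \<le> \<bar>y - x0\<bar>" by (auto simp: K_def m_def min_def abs_if split: if_splits)
          then have "1 \<le> 1 / m * \<bar>y - x0\<bar>" using m by (simp add: field_simps)
          then show ?thesis using y1 False by simp
        qed
        then have "\<bar>y * (1 - y)\<bar> * \<bar>f y\<bar> \<le> (indicator K y + 1 / m * \<bar>y - x0\<bar>) * \<bar>f y\<bar>"
          by (rule mult_right_mono) simp
        then show ?thesis by (simp add: abs_mult distrib_right)
      qed
      then show "AE y in lebesgue. y \<in> I01 \<longrightarrow> norm (y * (1 - y) * f y) \<le> norm (\<bar>indicator K y * f y\<bar> + 1 / m * \<bar>(y - x0) * f y\<bar>)"
        by (auto intro: order_trans[OF _ abs_ge_self])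
    qed
  qed
qed

text \<open>If \<open>v x0\<close> were not 0, then u^2 would be bounded below near
  \<open>x0\<close>, so u^2 / a would control 1 / a there; away from \<open>x0\<close> the lower
  bound on \<open>a\<close> does. Thus 1 / a would be integrable.\<close>

lemma weighted_L2_zero:
  fixes a u v :: "real \<Rightarrow> real"
  assumes cont: "continuous_on {0..1} a" and x0: "x0 \<in> {0..1}" and "a x0 = 0"
    and pos: "\<forall>x\<in>{0..1} - {x0}. 0 < a x"
    and nint: "\<not> set_integrable lebesgue I01 (\<lambda>x. 1 / a x)"
    and a: "\<And>x. x \<in> {0..1} \<Longrightarrow> (x - x0)\<^sup>2 \<le> C * a x"
    and u: "u \<in> L2w a" and v: "continuous_on {0..1} v" "ae_eq u v"
  shows "v x0 = 0"
proof (rule ccontr)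
  assume nz: "v x0 \<noteq> 0"
  define c where "c = \<bar>v x0\<bar> / 2"
  have c: "c > 0" using nz by (simp add: c_def)
  then obtain \<delta> where \<delta>: "\<delta> > 0" "\<And>x. x \<in> {0..1} \<Longrightarrow> \<bar>x - x0\<bar> < \<delta> \<Longrightarrow> \<bar>v x - v x0\<bar> < c"
    using v(1) x0 unfolding continuous_on_iff dist_real_def by blast
  have "set_integrable lebesgue I01 (\<lambda>x. 1 / a x)"
  proof (rule set_integrable_bound)
    have "set_integrable lebesgue I01 (\<lambda>x. (u x)\<^sup>2 / a x)"
      using u by (simp add: L2w_def)
    then show "set_integrable lebesgue I01 (\<lambda>x. 1 / c\<^sup>2 * ((u x)\<^sup>2 / a x) + \<bar>C\<bar> / \<delta>\<^sup>2)"
      by (intro set_integral_add(1) set_integrable_mult_right)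
        (auto intro: continuous_set_integrable_I01)
    have "(\<lambda>x. indicator I01 x *\<^sub>R a x) \<in> borel_measurable borel"
      by (intro borel_measurable_continuous_on_indicator continuous_on_subset[OF cont]) auto
    then have "(\<lambda>x. indicator I01 x *\<^sub>R a x) \<in> borel_measurable lebesgue"
      by (intro measurable_completion) simp
    \<comment> \<open>Inverting after the cutoff is harmless, because
      \<open>inverse 0 = 0\<close>.\<close>
    then have "(\<lambda>x. inverse (indicator I01 x *\<^sub>R a x)) \<in> borel_measurable lebesgue"
      by (rule borel_measurable_inverse)
    also have "(\<lambda>x. inverse (indicator I01 x *\<^sub>R a x)) = (\<lambda>x. indicator I01 x *\<^sub>R (1 / a x))"
      by (auto simp: indicator_def fun_eq_iff divide_inverse)
    finally show "set_borel_measurable lebesgue I01 (\<lambda>x. 1 / a x)"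
      by (simp add: set_borel_measurable_def)
    show "AE x in lebesgue. x \<in> I01 \<longrightarrow> norm (1 / a x) \<le> norm (1 / c\<^sup>2 * ((u x)\<^sup>2 / a x) + \<bar>C\<bar> / \<delta>\<^sup>2)"
      using v(2)[unfolded ae_eq_def]
    proof eventually_elim
      fix x assume uv: "x \<in> I01 \<longrightarrow> u x = v x"
      show "x \<in> I01 \<longrightarrow> norm (1 / a x) \<le> norm (1 / c\<^sup>2 * ((u x)\<^sup>2 / a x) + \<bar>C\<bar> / \<delta>\<^sup>2)"
      proof
        assume x: "x \<in> I01"
        show "norm (1 / a x) \<le> norm (1 / c\<^sup>2 * ((u x)\<^sup>2 / a x) + \<bar>C\<bar> / \<delta>\<^sup>2)"
        proof (cases "x = x0")
          case True
          \<comment> \<open>At \<open>x0\<close> the left side is 1 / 0, which is 0.\<close>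
          then show ?thesis using \<open>a x0 = 0\<close> by simp
        next
          case False
          then have ax: "a x > 0" using pos x by auto
          have "1 / a x \<le> 1 / c\<^sup>2 * ((u x)\<^sup>2 / a x) + \<bar>C\<bar> / \<delta>\<^sup>2"
          proof (cases "\<bar>x - x0\<bar> < \<delta>")
            case True
            then have "\<bar>v x - v x0\<bar> < c" using \<delta>(2) x by auto
            then have "c \<le> \<bar>v x\<bar>" unfolding c_def by linarith
            then have "c\<^sup>2 \<le> (u x)\<^sup>2" using c uv x by (metis abs_le_square_iff abs_of_pos)
            then have "1 / a x \<le> 1 / c\<^sup>2 * ((u x)\<^sup>2 / a x)"
              using c ax by (simp add: field_simps)
            then show ?thesis by (simp add: add_increasing2)
          next
            case False
            then have "\<delta>\<^sup>2 \<le> (x - x0)\<^sup>2" using \<delta>(1) by (metis abs_le_square_iff abs_of_pos not_less)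
            also have "\<dots> \<le> C * a x" using a x by auto
            \<comment> \<open>With the absolute value, the constant in the dominating function is
              nonnegative and can be added near \<open>x0\<close> too.\<close>
            also have "\<dots> \<le> \<bar>C\<bar> * a x" using ax by simp
            finally have "1 / a x \<le> \<bar>C\<bar> / \<delta>\<^sup>2" using ax \<delta>(1) by (simp add: field_simps)
            then show ?thesis using ax by (simp add: add_increasing)
          qed
          then show ?thesis using ax by simp
        qed
      qed
    qed
  qed
  with nint show False by blast
qed

section \<open>Equality of the two domains\<close>

theorem proposition3p5:
  fixes a :: "real \<Rightarrow> real" and x0 :: real
  assumes "continuous_on {0..1} a"
    and "\<forall>x\<in>{0..1}. 0 \<le> a x"
    and "x0 \<in> {0..1}"
    and "a x0 = 0"
    and "\<forall>x\<in>{0..1} - {x0}. 0 < a x"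
    and "\<not> set_integrable lebesgue {0<..<1} (\<lambda>x. 1 / a x)"
    and "\<exists>K\<in>{1..2}. \<exists>C>0. \<forall>x\<in>{0..1} - {x0}. 1 / a x \<le> C / \<bar>x - x0\<bar> powr K"
    and "a \<in> W1inf"
    and "x0 \<in> {0<..<1} \<longrightarrow> antimono_on {0..x0} a \<and> mono_on {x0..1} a"
    and "x0 = 0 \<longrightarrow> mono_on {0..1} a"
    and "x0 = 1 \<longrightarrow> antimono_on {0..1} a"
  shows "dom_A a = dom_D a x0"
proof
  show "dom_D a x0 \<subseteq> dom_A a" by (auto simp: dom_A_def dom_D_def)
  obtain C where C: "\<And>x. x \<in> {0..1} \<Longrightarrow> (x - x0)\<^sup>2 \<le> C * a x"
    using assms(7) square_dist_le_weight[OF assms(3,4,5)] by blast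
  show "dom_A a \<subseteq> dom_D a x0"
  proof
    fix u assume "u \<in> dom_A a"
    then obtain u4 where uH: "u \<in> H2w a" and u4: "weak_deriv 4 u u4" "(\<lambda>x. a x * u4 x) \<in> L2w a"
      by (auto simp: dom_A_def)
    \<comment> \<open>\<open>has_value\<close> at an end point already carries a continuous
      representative on all of [0,1], which can be evaluated at \<open>x0\<close>.\<close>
    obtain v where v: "continuous_on {0..1} v" "ae_eq u v"
      using uH by (auto simp: H2w_def H20_def has_value_def)
    have "v x0 = 0"
      using weighted_L2_zero[OF assms(1,3,4,5,6) C _ v] uH by (simp add: H2w_def)
    then have val0: "has_value u x0 0" using v by (auto simp: has_value_def)
    obtain u1 v1 where u1: "weak_deriv 1 u u1" and v1: "continuous_on {0..1} v1" "ae_eq u1 v1"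
      using uH by (auto simp: H2w_def H20_def has_value_def)
    have "has_value (\<lambda>x. a x * u1 x) x0 0"
      unfolding has_value_def
    proof (intro exI conjI)
      show "continuous_on {0..1} (\<lambda>x. a x * v1 x)" by (intro continuous_intros assms(1) v1)
      show "ae_eq (\<lambda>x. a x * u1 x) (\<lambda>x. a x * v1 x)"
        using v1(2) unfolding ae_eq_def by eventually_elim simp
      show "a x0 * v1 x0 = 0" using assms(4) by simp
    qed
    moreover obtain u2 where u2: "weak_deriv 2 u u2"
      using uH by (auto simp: H2w_def H20_def H2_def)
    have "u4 \<in> L1_loc" using u4 by (simp add: weak_deriv_def)
    then obtain w where w: "continuous_on {0..1} w" "ae_eq u2 w"
      using weak_deriv_2_continuous[OF u4(1) u2] weighted_L2_integrable[OF assms(3) C _ u4(2)] by blast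
    \<comment> \<open>As \<open>w\<close> is continuous across \<open>x0\<close>, so is the
      representative of a u'', and its limit there is \<open>a x0 * w x0 = 0\<close>.\<close>
    have c: "continuous_on {0..1} (\<lambda>x. a x * w x)" by (intro continuous_intros assms(1) w)
    have "has_limit_value (\<lambda>x. a x * u2 x) x0 0"
      unfolding has_limit_value_def
    proof (intro exI conjI)
      show "continuous_on ({0..1} - {x0}) (\<lambda>x. a x * w x)"
        by (rule continuous_on_subset[OF c]) auto
      show "ae_eq (\<lambda>x. a x * u2 x) (\<lambda>x. a x * w x)"
        using w(2) unfolding ae_eq_def by eventually_elim simp
      show "((\<lambda>x. a x * w x) \<longlongrightarrow> 0) (at x0 within {0..1})"
        using c[unfolded continuous_on_def, rule_format, OF assms(3)] assms(4) by simp
    qed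
    ultimately show "u \<in> dom_D a x0"
      using uH u4 val0 u1 u2 by (auto simp: dom_D_def)
  qed
qed

end
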